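(* Let $n\ge 2$, let $x_0<x_1<\cdots<x_n$ be real numbers and $u_0,\dots,u_n\in\mathbf{R}_F$ fuzzy numbers, and put $I=[x_0,x_n]$, $I_i=[x_{i-1},x_i]$ for $i=1,\dots,n$. For each $i\in\{1,\dots,n\}$ let $0\le s_i<e_i\le n$ be integers with $e_i-s_i\ge 2$, put $\tilde I_{\sigma(i)}=[x_{s_i},x_{e_i}]$, and define $\tilde l_i:\tilde I_{\sigma(i)}\to I_i$ by $$\tilde l_i(x)=\frac{x_i-x_{i-1}}{x_{e_i}-x_{s_i}}(x-x_{s_i})+x_{i-1},$$ where it is assumed that $\frac{x_i-x_{i-1}}{x_{e_i}-x_{s_i}}<1$. Let $0\le\alpha_i<1$ and let $\tilde{\mathbf q}_i:I_i\to\mathbf{R}_F$ be Lipschitz mappings such that $\tilde{\mathbf F}_i:\tilde I_{\sigma(i)}\times\mathbf{R}_F\to\mathbf{R}_F$, $\tilde{\mathbf F}_i(x,u)=\alpha_i u\oplus\tilde{\mathbf q}_i(\tilde l_i(x))$, satisfies $\tilde{\mathbf F}_i(x_{s_i},u_{s_i})=u_{i-1}$ and $\tilde{\mathbf F}_i(x_{e_i},u_{e_i})=u_i$. Define $\tilde{\mathbf w}_i:\tilde I_{\sigma(i)}\times\mathbf{R}_F\to I_i\times\mathbf{R}_F$ by $\tilde{\mathbf w}_i(x,u)=(\tilde l_i(x),\tilde{\mathbf F}_i(x,u))$. Let $M=(p_{st})_{n\times n}$ be given by $p_{st}=1/a_s$ if $I_s\subseteq\tilde I_{\sigma(t)}$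 and $p_{st}=0$ otherwise, where $a_s$ is the number of indices $i$ with $I_s\subseteq\tilde I_{\sigma(i)}$, and assume $M$ is irreducible. Let $A\subset I\times\mathbf{R}_F$ be the attractor of the recurrent iterated function system $\{I\times\mathbf{R}_F;M;\tilde{\mathbf w}_i,\ i=1,\dots,n\}$. Then $A$ is the graph of a continuous fuzzy valued function, i.e. there is a continuous $\tilde{\mathbf f}:I\to\mathbf{R}_F$ such that $A=\{(x,\tilde{\mathbf f}(x)):x\in I\}$.
   Context: $\mathbf{R}_F$ is the space of fuzzy numbers over $\mathbf{R}$ (normal, fuzzy convex, upper semicontinuous functions $u:\mathbf{R}\to[0,1]$ with compact support). For $u\in\mathbf{R}_F$ and $0\le\lambda\le1$ the $\lambda$-level set is the compact interval $[u]^\lambda=[u^-(\lambda),u^+(\lambda)]$ (for $\lambda=0$, the closure of the support). Addition $\oplus$ and multiplication by a real scalar $\alpha\ge0$ are levelwise: $(u\oplus v)^\pm(\lambda)=u^\pm(\lambda)+v^\pm(\lambda)$, $(\alpha u)^\pm(\lambda)=\alpha u^\pm(\lambda)$. The metric on $\mathbf{R}_F$ is $d_\infty(u,v)=\sup_{\lambda\in[0,1]}\max\{|u^-(\lambda)-v^-(\lambda)|,|u^+(\lambda)-v^+(\lambda)|\}$; $(\mathbf{R}_F,d_\infty)$ is complete. Let $L_{\tilde{\mathbf q}_i}$ be a Lipschitz constant of $\tilde{\mathbf q}_i$ and $c_{\tilde l_i}=\frac{x_i-x_{i-1}}{x_{e_i}-x_{s_i}}$. The space $I\times\mathbf{R}_F$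 carries the complete metric $d_\theta((x,u),(y,v))=|x-y|+\theta d_\infty(u,v)$ with $0<\theta<\frac{1-\max_i c_{\tilde l_i}}{\max_i(L_{\tilde{\mathbf q}_i}c_{\tilde l_i})}$ (any $\theta>0$ if the denominator is $0$), for which each $\tilde{\mathbf w}_i$ is a contraction. Attractor of the recurrent iterated function system: for $i=1,\dots,n$ put $\Lambda(i)=\{j: I_j\subseteq\tilde I_{\sigma(i)}\}$. On $n$-tuples $B=(B_1,\dots,B_n)$ of nonempty compact sets $B_j\subset I_j\times\mathbf{R}_F$ define $\tilde{\mathbf W}(B)=\left(\bigcup_{j\in\Lambda(1)}\tilde{\mathbf w}_1(B_j),\dots,\bigcup_{j\in\Lambda(n)}\tilde{\mathbf w}_n(B_j)\right)$. This map is a contraction for the maximum of the componentwise Hausdorff distances induced by $d_\theta$, so there is a unique tuple $(A_1,\dots,A_n)$ with $A_i=\bigcup_{j\in\Lambda(i)}\tilde{\mathbf w}_i(A_j)$ for all $i$. The attractor is $A=\bigcup_{i=1}^nA_i$. *)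

theory Defs
  imports "HOL-Analysis.Analysis"
begin

section \<open>Fuzzy numbers\<close>

definition upper_semicontinuous :: "(real \<Rightarrow> real) \<Rightarrow> bool" where
  "upper_semicontinuous u \<longleftrightarrow> (\<forall>x c. u x < c \<longrightarrow> (\<forall>\<^sub>F y in at x. u y < c))"

definition fuzzy_convex :: "(real \<Rightarrow> real) \<Rightarrow> bool" where
  "fuzzy_convex u \<longleftrightarrow>
     (\<forall>x y t. 0 \<le> t \<and> t \<le> 1 \<longrightarrow> min (u x) (u y) \<le> u ((1 - t) * x + t * y))"

definition is_fuzzy_number :: "(real \<Rightarrow> real) \<Rightarrow> bool" where
  "is_fuzzy_number u \<longleftrightarrow>
     (\<forall>x. u x \<in> {0..1}) \<and> (\<exists>x. u x = 1) \<and> fuzzy_convex u \<and>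
     upper_semicontinuous u \<and> compact (closure {x. 0 < u x})"

typedef fuzzy = "{u. is_fuzzy_number u}"
  morphisms membership Abs_fuzzy
proof -
  have "is_fuzzy_number (\<lambda>x. if x = 0 then 1 else 0)"
    unfolding is_fuzzy_number_def
  proof (intro conjI)
    show "fuzzy_convex (\<lambda>x. if x = 0 then 1 else 0)"
      by (auto simp: fuzzy_convex_def)
    show "upper_semicontinuous (\<lambda>x. if x = 0 then 1 else 0)"
      unfolding upper_semicontinuous_def
    proof (intro allI impI)
      fix x c :: real
      assume c: "(if x = 0 then 1 else 0) < c"
      have ne: "\<forall>\<^sub>F y in at x. y \<noteq> 0"
        using eventually_neq_at_within[of 0 x UNIV] by simp
      show "\<forall>\<^sub>F y in at x. (if y = 0 then 1 else 0) < c"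
        using ne by (rule eventually_mono) (use c in \<open>auto split: if_splits\<close>)
    qed
    have "{x::real. 0 < (if x = 0 then 1 else (0::real))} = {0}" by auto
    then show "compact (closure {x::real. 0 < (if x = 0 then 1 else (0::real))})"
      by simp
  qed auto
  then show ?thesis by blast
qed

definition level :: "fuzzy \<Rightarrow> real \<Rightarrow> real set" where
  "level u \<rho> = (if \<rho> = 0 then closure {x. 0 < membership u x} else {x. \<rho> \<le> membership u x})"

definition lower :: "fuzzy \<Rightarrow> real \<Rightarrow> real" where
  "lower u \<rho> = Inf (level u \<rho>)"

definition upper :: "fuzzy \<Rightarrow> real \<Rightarrow> real" where
  "upper u \<rho> = Sup (level u \<rho>)"

lemma membership_fuzzy: "is_fuzzy_number (membership u)"
  using membership by simp

lemma membership_range: "0 \<le> membership u x" "membership u x \<le> 1"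
  using membership_fuzzy[of u] by (auto simp: is_fuzzy_number_def)

lemma level_mono:
  assumes "0 \<le> \<mu>" "\<mu> \<le> \<rho>"
  shows "level u \<rho> \<subseteq> level u \<mu>"
proof (cases "\<mu> = 0")
  case True
  then show ?thesis
    using assms closure_subset[of "{x. 0 < membership u x}"] by (auto simp: level_def)
next
  case False
  then show ?thesis using assms by (auto simp: level_def)
qed

lemma level_nonempty: "\<rho> \<in> {0..1} \<Longrightarrow> level u \<rho> \<noteq> {}"
proof -
  assume l: "\<rho> \<in> {0..1}"
  obtain x where "membership u x = 1"
    using membership_fuzzy[of u] by (auto simp: is_fuzzy_number_def)
  then have "x \<in> level u 1" by (simp add: level_def)
  then show ?thesis using level_mono[of \<rho> 1 u] l by auto
qed

lemma level_convex: "convex (level u \<rho>)"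
proof -
  have fc: "fuzzy_convex (membership u)"
    using membership_fuzzy[of u] by (auto simp: is_fuzzy_number_def)
  have "convex {x. 0 < membership u x}"
    unfolding convex_alt
  proof (intro ballI allI impI)
    fix x y t :: real
    assume "x \<in> {x. 0 < membership u x}" "y \<in> {x. 0 < membership u x}" "0 \<le> t \<and> t \<le> 1"
    moreover from this have "min (membership u x) (membership u y)
        \<le> membership u ((1 - t) * x + t * y)"
      using fc unfolding fuzzy_convex_def by blast
    ultimately show "(1 - t) *\<^sub>R x + t *\<^sub>R y \<in> {x. 0 < membership u x}"
      by auto
  qed
  moreover have "convex {x. \<rho> \<le> membership u x}"
    unfolding convex_alt
  proof (intro ballI allI impI)
    fix x y t :: real
    assume "x \<in> {x. \<rho> \<le> membership u x}" "y \<in> {x. \<rho> \<le> membership u x}" "0 \<le> t \<and> t \<le> 1"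
    moreover from this have "min (membership u x) (membership u y)
        \<le> membership u ((1 - t) * x + t * y)"
      using fc unfolding fuzzy_convex_def by blast
    ultimately show "(1 - t) *\<^sub>R x + t *\<^sub>R y \<in> {x. \<rho> \<le> membership u x}"
      by auto
  qed
  ultimately show ?thesis by (simp add: level_def convex_closure)
qed

lemma level_compact:
  assumes "\<rho> \<in> {0..1}"
  shows "compact (level u \<rho>)"
proof -
  have c0: "compact (level u 0)"
    using membership_fuzzy[of u] by (auto simp: is_fuzzy_number_def level_def)
  show ?thesis
  proof (cases "\<rho> = 0")
    case False
    have usc: "upper_semicontinuous (membership u)"
      using membership_fuzzy[of u] by (auto simp: is_fuzzy_number_def)
    have "open {x. membership u x < \<rho>}"
    proof (subst open_subopen, intro ballI)
      fix x assume "x \<in> {x. membership u x < \<rho>}"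
      then have "membership u x < \<rho>" by simp
      moreover from this have "\<forall>\<^sub>F y in at x. membership u y < \<rho>"
        using usc by (auto simp: upper_semicontinuous_def)
      ultimately have "\<forall>\<^sub>F y in nhds x. membership u y < \<rho>"
        by (auto simp: eventually_nhds_conv_at)
      then show "\<exists>T. open T \<and> x \<in> T \<and> T \<subseteq> {x. membership u x < \<rho>}"
        by (auto simp: eventually_nhds)
    qed
    moreover have "level u \<rho> = - {x. membership u x < \<rho>}"
      using False by (auto simp: level_def)
    ultimately have "closed (level u \<rho>)" by (simp add: closed_Compl)
    then have "compact (level u 0 \<inter> level u \<rho>)" using c0 by (simp add: compact_Int_closed)
    then show ?thesis using level_mono[of 0 \<rho> u] assms by (simp add: Int_absorb1)
  qed (use c0 in simp)
qed

lemma
  assumes "\<rho> \<in> {0..1}"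
  shows level_eq: "level u \<rho> = {lower u \<rho>..upper u \<rho>}"
    and lower_le_upper: "lower u \<rho> \<le> upper u \<rho>"
proof -
  obtain a b where ab: "level u \<rho> = {a..b}"
    using connected_compact_interval_1[of "level u \<rho>"] level_compact[OF assms]
      convex_connected[OF level_convex] by blast
  moreover have "a \<le> b" using level_nonempty[OF assms, of u] ab by auto
  ultimately show "level u \<rho> = {lower u \<rho>..upper u \<rho>}" "lower u \<rho> \<le> upper u \<rho>"
    by (simp_all add: lower_def upper_def)
qed

lemma lower_upper_mono:
  assumes "0 \<le> \<mu>" "\<mu> \<le> \<rho>" "\<rho> \<le> 1"
  shows "lower u \<mu> \<le> lower u \<rho>" "upper u \<rho> \<le> upper u \<mu>"
  using level_mono[OF assms(1,2), of u] level_eq[of \<rho> u] level_eq[of \<mu> u]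
    lower_le_upper[of \<rho> u] assms by auto

lemma fuzzy_eqI:
  assumes "\<And>\<rho>. \<rho> \<in> {0..1} \<Longrightarrow> lower u \<rho> = lower v \<rho>"
    and "\<And>\<rho>. \<rho> \<in> {0..1} \<Longrightarrow> upper u \<rho> = upper v \<rho>"
  shows "u = v"
proof -
  have lev: "level u \<rho> = level v \<rho>" if "\<rho> \<in> {0..1}" for \<rho>
    using level_eq[OF that, of u] level_eq[OF that, of v] assms that by auto
  have "membership u x = membership v x" for x
  proof (rule antisym; rule ccontr)
    assume "\<not> membership u x \<le> membership v x"
    then have "x \<in> level u (membership u x)" "x \<notin> level v (membership u x)"
      using membership_range[of v x] by (auto simp: level_def)
    then show False using lev[of "membership u x"] membership_range[of u x] by auto
  next
    assume "\<not> membership v x \<le> membership u x"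
    then have "x \<in> level v (membership v x)" "x \<notin> level u (membership v x)"
      using membership_range[of u x] by (auto simp: level_def)
    then show False using lev[of "membership v x"] membership_range[of v x] by auto
  qed
  then show ?thesis by (simp add: membership_inject[symmetric] fun_eq_iff)
qed


subsection \<open>The metric space of fuzzy numbers\<close>

definition level_gap :: "fuzzy \<Rightarrow> fuzzy \<Rightarrow> real \<Rightarrow> real" where
  "level_gap u v \<rho> = max \<bar>lower u \<rho> - lower v \<rho>\<bar> \<bar>upper u \<rho> - upper v \<rho>\<bar>"

lemma level_gap_bdd: "bdd_above (level_gap u v ` {0..1})"
proof (rule bdd_aboveI2)
  fix \<rho> :: real assume l: "\<rho> \<in> {0..1}"
  show "level_gap u v \<rho> \<le> \<bar>lower u 0\<bar> + \<bar>upper u 0\<bar> + \<bar>lower v 0\<bar> + \<bar>upper v 0\<bar>"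
    using lower_upper_mono[of 0 \<rho> u] lower_upper_mono[of 0 \<rho> v] l
      lower_le_upper[of \<rho> u] lower_le_upper[of \<rho> v]
    unfolding level_gap_def by auto
qed

instantiation fuzzy :: metric_space
begin

definition dist_fuzzy :: "fuzzy \<Rightarrow> fuzzy \<Rightarrow> real" where
  "dist u v = (SUP \<rho>\<in>{0..1}. max \<bar>lower u \<rho> - lower v \<rho>\<bar> \<bar>upper u \<rho> - upper v \<rho>\<bar>)"

definition uniformity_fuzzy :: "(fuzzy \<times> fuzzy) filter" where
  "uniformity_fuzzy = (INF e\<in>{0 <..}. principal {(u, v). dist u v < e})"

definition open_fuzzy :: "fuzzy set \<Rightarrow> bool" where
  "open_fuzzy U = (\<forall>u\<in>U. \<forall>\<^sub>F (u', v) in uniformity. u' = u \<longrightarrow> v \<in> U)"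

lemma dist_fuzzy_gap: "dist u v = (SUP \<rho>\<in>{0..1}. level_gap u v \<rho>)"
  by (simp add: dist_fuzzy_def level_gap_def)

lemma level_gap_le_dist: "\<rho> \<in> {0..1} \<Longrightarrow> level_gap u v \<rho> \<le> dist u v"
  unfolding dist_fuzzy_gap by (rule cSUP_upper[OF _ level_gap_bdd])

lemma dist_fuzzy_leI: "(\<And>\<rho>. \<rho> \<in> {0..1} \<Longrightarrow> level_gap u v \<rho> \<le> b) \<Longrightarrow> dist u v \<le> b"
  unfolding dist_fuzzy_gap by (rule cSUP_least) auto

instance
proof
  fix u v w :: fuzzy
  show "dist u v = 0 \<longleftrightarrow> u = v"
  proof
    assume "dist u v = 0"
    then have "level_gap u v \<rho> \<le> 0" if "\<rho> \<in> {0..1}" for \<rho>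
      using level_gap_le_dist[OF that, of u v] by simp
    then show "u = v"
      by (intro fuzzy_eqI) (force simp: level_gap_def)+
  next
    assume "u = v"
    then show "dist u v = 0" by (simp add: dist_fuzzy_def)
  qed
  show "dist u v \<le> dist u w + dist v w"
  proof (rule dist_fuzzy_leI)
    fix \<rho> :: real assume l: "\<rho> \<in> {0..1}"
    show "level_gap u v \<rho> \<le> dist u w + dist v w"
      using level_gap_le_dist[OF l, of u w] level_gap_le_dist[OF l, of v w]
      unfolding level_gap_def by linarith
  qed
qed (simp_all add: uniformity_fuzzy_def open_fuzzy_def)

end


subsection \<open>Addition and nonnegative scalar multiplication\<close>

definition fuzzy_add :: "fuzzy \<Rightarrow> fuzzy \<Rightarrow> fuzzy" (infixl "\<oplus>\<^sub>F" 65) where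
  "u \<oplus>\<^sub>F v = (THE w. \<forall>\<rho>\<in>{0..1}.
     lower w \<rho> = lower u \<rho> + lower v \<rho> \<and> upper w \<rho> = upper u \<rho> + upper v \<rho>)"

(* Meaningful for \<alpha> \<ge> 0 only: a negative factor would exchange the two endpoints. *)
definition fuzzy_scale :: "real \<Rightarrow> fuzzy \<Rightarrow> fuzzy" (infixr "\<cdot>\<^sub>F" 75) where
  "\<alpha> \<cdot>\<^sub>F u = (THE w. \<forall>\<rho>\<in>{0..1}.
     lower w \<rho> = \<alpha> * lower u \<rho> \<and> upper w \<rho> = \<alpha> * upper u \<rho>)"

text \<open>
  That the fuzzy numbers described above exist follows from the characterization of the
  endpoint functions: monotone, left-continuous on \<open>(0,1]\<close> and right-continuous at \<open>0\<close>.
\<close>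

lemma lower_left_cont:
  assumes l: "0 < \<rho>" "\<rho> \<le> 1"
  shows "(lower u \<longlongrightarrow> lower u \<rho>) (at_left \<rho>)"
proof (rule order_tendstoI)
  fix y assume y: "y < lower u \<rho>"
  then have "y \<notin> level u \<rho>" using level_eq[of \<rho> u] l by auto
  then have m: "membership u y < \<rho>" using l by (auto simp: level_def)
  have "\<forall>\<^sub>F \<mu> in at_left \<rho>. \<mu> \<in> {membership u y<..<\<rho>}"
    using m by (rule eventually_at_left_real)
  then show "\<forall>\<^sub>F \<mu> in at_left \<rho>. y < lower u \<mu>"
  proof (rule eventually_mono)
    fix \<mu> assume mu: "\<mu> \<in> {membership u y<..<\<rho>}"
    then have pos: "0 < \<mu>" using membership_range[of u y] by simp
    then have "y \<notin> level u \<mu>" using mu by (auto simp: level_def)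
    moreover have "y \<le> upper u \<mu>"
      using y lower_le_upper[of \<rho> u] lower_upper_mono[of \<mu> \<rho> u] mu pos l by auto
    ultimately show "y < lower u \<mu>" using level_eq[of \<mu> u] mu pos l by auto
  qed
next
  fix y assume y: "lower u \<rho> < y"
  have "\<forall>\<^sub>F \<mu> in at_left \<rho>. \<mu> \<in> {0<..<\<rho>}"
    using l(1) by (rule eventually_at_left_real)
  then show "\<forall>\<^sub>F \<mu> in at_left \<rho>. lower u \<mu> < y"
  proof (rule eventually_mono)
    fix \<mu> assume "\<mu> \<in> {0<..<\<rho>}"
    then show "lower u \<mu> < y" using lower_upper_mono[of \<mu> \<rho> u] l y by auto
  qed
qed

lemma upper_left_cont:
  assumes l: "0 < \<rho>" "\<rho> \<le> 1"
  shows "(upper u \<longlongrightarrow> upper u \<rho>) (at_left \<rho>)"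
proof (rule order_tendstoI)
  fix y assume y: "y < upper u \<rho>"
  have "\<forall>\<^sub>F \<mu> in at_left \<rho>. \<mu> \<in> {0<..<\<rho>}"
    using l(1) by (rule eventually_at_left_real)
  then show "\<forall>\<^sub>F \<mu> in at_left \<rho>. y < upper u \<mu>"
  proof (rule eventually_mono)
    fix \<mu> assume "\<mu> \<in> {0<..<\<rho>}"
    then show "y < upper u \<mu>" using lower_upper_mono[of \<mu> \<rho> u] l y by auto
  qed
next
  fix y assume y: "upper u \<rho> < y"
  then have "y \<notin> level u \<rho>" using level_eq[of \<rho> u] l by auto
  then have m: "membership u y < \<rho>" using l by (auto simp: level_def)
  have "\<forall>\<^sub>F \<mu> in at_left \<rho>. \<mu> \<in> {membership u y<..<\<rho>}"
    using m by (rule eventually_at_left_real)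
  then show "\<forall>\<^sub>F \<mu> in at_left \<rho>. upper u \<mu> < y"
  proof (rule eventually_mono)
    fix \<mu> assume mu: "\<mu> \<in> {membership u y<..<\<rho>}"
    then have pos: "0 < \<mu>" using membership_range[of u y] by simp
    then have "y \<notin> level u \<mu>" using mu by (auto simp: level_def)
    moreover have "lower u \<mu> \<le> y"
      using y lower_le_upper[of \<rho> u] lower_upper_mono[of \<mu> \<rho> u] mu pos l by auto
    ultimately show "upper u \<mu> < y" using level_eq[of \<mu> u] mu pos l by auto
  qed
qed

lemma lower_right_cont0: "(lower u \<longlongrightarrow> lower u 0) (at_right 0)"
proof (rule order_tendstoI)
  fix y assume y: "y < lower u 0"
  have "\<forall>\<^sub>F \<mu> in at_right (0::real). \<mu> \<in> {0<..<1}"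
    by (rule eventually_at_right_real) simp
  then show "\<forall>\<^sub>F \<mu> in at_right 0. y < lower u \<mu>"
  proof (rule eventually_mono)
    fix \<mu> :: real assume "\<mu> \<in> {0<..<1}"
    then show "y < lower u \<mu>" using lower_upper_mono[of 0 \<mu> u] y by auto
  qed
next
  fix y assume y: "lower u 0 < y"
  have "lower u 0 \<in> closure {x. 0 < membership u x}"
    using level_eq[of 0 u] lower_le_upper[of 0 u] by (auto simp: level_def)
  then obtain z where z: "0 < membership u z" "dist z (lower u 0) < y - lower u 0"
    using y unfolding closure_approachable by (meson diff_gt_0_iff_gt mem_Collect_eq)
  have "\<forall>\<^sub>F \<mu> in at_right (0::real). \<mu> \<in> {0<..<membership u z}"
    using z(1) by (rule eventually_at_right_real)
  then show "\<forall>\<^sub>F \<mu> in at_right 0. lower u \<mu> < y"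
  proof (rule eventually_mono)
    fix \<mu> :: real assume mu: "\<mu> \<in> {0<..<membership u z}"
    then have "z \<in> level u \<mu>" by (auto simp: level_def)
    moreover have "\<mu> \<in> {0..1}" using mu membership_range[of u z] by auto
    ultimately have "lower u \<mu> \<le> z" using level_eq[of \<mu> u] by auto
    then show "lower u \<mu> < y" using z(2) by (simp add: dist_real_def)
  qed
qed

lemma upper_right_cont0: "(upper u \<longlongrightarrow> upper u 0) (at_right 0)"
proof (rule order_tendstoI)
  fix y assume y: "upper u 0 < y"
  have "\<forall>\<^sub>F \<mu> in at_right (0::real). \<mu> \<in> {0<..<1}"
    by (rule eventually_at_right_real) simp
  then show "\<forall>\<^sub>F \<mu> in at_right 0. upper u \<mu> < y"
  proof (rule eventually_mono)
    fix \<mu> :: real assume "\<mu> \<in> {0<..<1}"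
    then show "upper u \<mu> < y" using lower_upper_mono[of 0 \<mu> u] y by auto
  qed
next
  fix y assume y: "y < upper u 0"
  have "upper u 0 \<in> closure {x. 0 < membership u x}"
    using level_eq[of 0 u] lower_le_upper[of 0 u] by (auto simp: level_def)
  then obtain z where z: "0 < membership u z" "dist z (upper u 0) < upper u 0 - y"
    using y unfolding closure_approachable by (meson diff_gt_0_iff_gt mem_Collect_eq)
  have "\<forall>\<^sub>F \<mu> in at_right (0::real). \<mu> \<in> {0<..<membership u z}"
    using z(1) by (rule eventually_at_right_real)
  then show "\<forall>\<^sub>F \<mu> in at_right 0. y < upper u \<mu>"
  proof (rule eventually_mono)
    fix \<mu> :: real assume mu: "\<mu> \<in> {0<..<membership u z}"
    then have "z \<in> level u \<mu>" by (auto simp: level_def)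
    moreover have "\<mu> \<in> {0..1}" using mu membership_range[of u z] by auto
    ultimately have "z \<le> upper u \<mu>" using level_eq[of \<mu> u] by auto
    then show "y < upper u \<mu>" using z(2) by (simp add: dist_real_def)
  qed
qed

lemma fuzzy_representation:
  fixes a b :: "real \<Rightarrow> real"
  assumes le: "\<And>\<rho>. \<rho> \<in> {0..1} \<Longrightarrow> a \<rho> \<le> b \<rho>"
    and a_mono: "\<And>\<mu> \<rho>. 0 \<le> \<mu> \<Longrightarrow> \<mu> \<le> \<rho> \<Longrightarrow> \<rho> \<le> 1 \<Longrightarrow> a \<mu> \<le> a \<rho>"
    and b_mono: "\<And>\<mu> \<rho>. 0 \<le> \<mu> \<Longrightarrow> \<mu> \<le> \<rho> \<Longrightarrow> \<rho> \<le> 1 \<Longrightarrow> b \<rho> \<le> b \<mu>"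
    and a_left: "\<And>\<rho>. 0 < \<rho> \<Longrightarrow> \<rho> \<le> 1 \<Longrightarrow> (a \<longlongrightarrow> a \<rho>) (at_left \<rho>)"
    and b_left: "\<And>\<rho>. 0 < \<rho> \<Longrightarrow> \<rho> \<le> 1 \<Longrightarrow> (b \<longlongrightarrow> b \<rho>) (at_left \<rho>)"
    and a_right: "(a \<longlongrightarrow> a 0) (at_right 0)"
    and b_right: "(b \<longlongrightarrow> b 0) (at_right 0)"
  shows "\<exists>!w. \<forall>\<rho>\<in>{0..1}. lower w \<rho> = a \<rho> \<and> upper w \<rho> = b \<rho>"
proof -
  define S where "S x = insert 0 {\<rho>. 0 < \<rho> \<and> \<rho> \<le> 1 \<and> a \<rho> \<le> x \<and> x \<le> b \<rho>}" for x
  define m where "m x = Sup (S x)" for x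
  have S_bdd: "bdd_above (S x)" for x
    by (rule bdd_aboveI[of _ 1]) (auto simp: S_def)
  have S_ne: "S x \<noteq> {}" for x by (auto simp: S_def)
  have m0: "0 \<le> m x" for x
    unfolding m_def by (rule cSup_upper[OF _ S_bdd]) (simp add: S_def)
  have m1: "m x \<le> 1" for x
    unfolding m_def by (rule cSup_least[OF S_ne]) (auto simp: S_def)
  have m_iff: "\<rho> \<le> m x \<longleftrightarrow> a \<rho> \<le> x \<and> x \<le> b \<rho>" if l: "0 < \<rho>" "\<rho> \<le> 1" for \<rho> x
  proof
    assume "a \<rho> \<le> x \<and> x \<le> b \<rho>"
    then have "\<rho> \<in> S x" using l by (simp add: S_def)
    then show "\<rho> \<le> m x" unfolding m_def by (rule cSup_upper[OF _ S_bdd])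
  next
    assume lm: "\<rho> \<le> m x"
    have below: "a \<mu> \<le> x \<and> x \<le> b \<mu>" if mu: "0 < \<mu>" "\<mu> < \<rho>" for \<mu>
    proof -
      have "\<mu> < Sup (S x)" using mu lm by (simp add: m_def)
      then obtain \<nu> where nu: "\<nu> \<in> S x" "\<mu> < \<nu>"
        using less_cSup_iff[OF S_ne S_bdd] by blast
      then show ?thesis
        using a_mono[of \<mu> \<nu>] b_mono[of \<mu> \<nu>] mu by (auto simp: S_def)
    qed
    have ev: "\<forall>\<^sub>F \<mu> in at_left \<rho>. \<mu> \<in> {0<..<\<rho>}"
      using l(1) by (rule eventually_at_left_real)
    have "a \<rho> \<le> x"
      by (rule tendsto_upperbound[OF a_left[OF l]])
        (use ev below in \<open>auto elim!: eventually_mono\<close>)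
    moreover have "x \<le> b \<rho>"
      by (rule tendsto_lowerbound[OF b_left[OF l]])
        (use ev below in \<open>auto elim!: eventually_mono\<close>)
    ultimately show "a \<rho> \<le> x \<and> x \<le> b \<rho>" by simp
  qed
  have lev: "{x. \<rho> \<le> m x} = {a \<rho>..b \<rho>}" if "0 < \<rho>" "\<rho> \<le> 1" for \<rho>
    by (rule set_eqI) (simp only: mem_Collect_eq m_iff[OF that] atLeastAtMost_iff)
  have supp: "{x. 0 < m x} \<subseteq> {a 0..b 0}"
  proof
    fix x assume "x \<in> {x. 0 < m x}"
    then have "0 < m x" by simp
    then show "x \<in> {a 0..b 0}"
      using m_iff[of "m x" x] m1[of x] a_mono[of 0 "m x"] b_mono[of 0 "m x"] by auto
  qed
  have "is_fuzzy_number m"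
    unfolding is_fuzzy_number_def
  proof (intro conjI allI)
    show "m x \<in> {0..1}" for x using m0 m1 by simp
    have "a 1 \<in> {x. 1 \<le> m x}" using lev[of 1] le[of 1] by auto
    then show "\<exists>x. m x = 1" using m1 by (metis antisym mem_Collect_eq)
    show "fuzzy_convex m"
      unfolding fuzzy_convex_def
    proof (intro allI impI)
      fix x y t :: real assume t: "0 \<le> t \<and> t \<le> 1"
      define \<rho> where "\<rho> = min (m x) (m y)"
      show "min (m x) (m y) \<le> m ((1 - t) * x + t * y)"
      proof (cases "0 < \<rho>")
        case True
        have l1: "\<rho> \<le> 1" using m1[of x] by (simp add: \<rho>_def)
        have "x \<in> {a \<rho>..b \<rho>}" "y \<in> {a \<rho>..b \<rho>}"
          using lev[OF True l1] by (auto simp: \<rho>_def)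
        then have "(1 - t) *\<^sub>R x + t *\<^sub>R y \<in> {a \<rho>..b \<rho>}"
          using t by (intro convexD_alt) auto
        then have "(1 - t) * x + t * y \<in> {x. \<rho> \<le> m x}" using lev[OF True l1] by simp
        then show ?thesis by (simp add: \<rho>_def)
      next
        case False
        then show ?thesis using m0[of "(1 - t) * x + t * y"] unfolding \<rho>_def by linarith
      qed
    qed
    show "upper_semicontinuous m"
      unfolding upper_semicontinuous_def
    proof (intro allI impI)
      fix x c assume c: "m x < c"
      show "\<forall>\<^sub>F y in at x. m y < c"
      proof (cases "c \<le> 1")
        case True
        have "0 < c" using c m0[of x] by simp
        then have "- {x. c \<le> m x} = - {a c..b c}" using lev[of c] True by simp
        then have "open (- {x. c \<le> m x})" by (metis closed_atLeastAtMost open_Compl)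
        moreover have "x \<in> - {x. c \<le> m x}" using c by simp
        ultimately have "\<forall>\<^sub>F y in at x. y \<in> - {x. c \<le> m x}"
          by (meson eventually_at_topological)
        then show ?thesis by (rule eventually_mono) auto
      next
        case False
        then have "m y < c" for y using m1[of y] by simp
        then show ?thesis by simp
      qed
    qed
    have "bounded {x. 0 < m x}" by (rule bounded_subset[OF _ supp]) simp
    then show "compact (closure {x. 0 < m x})" by simp
  qed
  then have mem: "membership (Abs_fuzzy m) = m" by (simp add: Abs_fuzzy_inverse)
  have lw: "level (Abs_fuzzy m) \<rho> = {a \<rho>..b \<rho>}" if l: "\<rho> \<in> {0..1}" for \<rho>
  proof (cases "\<rho> = 0")
    case False
    then show ?thesis using lev[of \<rho>] l by (simp add: level_def mem)
  next
    case True
    have cl: "closure {x. 0 < m x} \<subseteq> {a 0..b 0}"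
      using supp by (rule closure_minimal) simp
    have sub: "{a \<mu>..b \<mu>} \<subseteq> closure {x. 0 < m x}" if "\<mu> \<in> {0<..<1}" for \<mu>
      using lev[of \<mu>] that closure_subset[of "{x. 0 < m x}"] by force
    have ev: "\<forall>\<^sub>F \<mu> in at_right (0::real). \<mu> \<in> {0<..<1}"
      by (rule eventually_at_right_real) simp
    have "a 0 \<in> closure {x. 0 < m x}"
    proof (rule Lim_in_closed_set[OF closed_closure _ _ a_right])
      show "\<forall>\<^sub>F \<mu> in at_right 0. a \<mu> \<in> closure {x. 0 < m x}"
        using ev by (rule eventually_mono) (use sub le in force)
    qed simp
    moreover have "b 0 \<in> closure {x. 0 < m x}"
    proof (rule Lim_in_closed_set[OF closed_closure _ _ b_right])
      show "\<forall>\<^sub>F \<mu> in at_right 0. b \<mu> \<in> closure {x. 0 < m x}"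
        using ev by (rule eventually_mono) (use sub le in force)
    qed simp
    moreover have "convex (closure {x. 0 < m x})"
      using level_convex[of "Abs_fuzzy m" 0] by (simp add: level_def mem)
    ultimately have "closed_segment (a 0) (b 0) \<subseteq> closure {x. 0 < m x}"
      by (simp add: closed_segment_subset)
    then show ?thesis
      using cl True le[of 0] by (auto simp: level_def mem closed_segment_eq_real_ivl)
  qed
  have ex: "\<forall>\<rho>\<in>{0..1}. lower (Abs_fuzzy m) \<rho> = a \<rho> \<and> upper (Abs_fuzzy m) \<rho> = b \<rho>"
    using lw le by (simp add: lower_def upper_def)
  show ?thesis
  proof (rule ex1I[of _ "Abs_fuzzy m"])
    show "\<forall>\<rho>\<in>{0..1}. lower (Abs_fuzzy m) \<rho> = a \<rho> \<and> upper (Abs_fuzzy m) \<rho> = b \<rho>"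
      by (rule ex)
    fix w assume "\<forall>\<rho>\<in>{0..1}. lower w \<rho> = a \<rho> \<and> upper w \<rho> = b \<rho>"
    then show "w = Abs_fuzzy m" using ex by (intro fuzzy_eqI) auto
  qed
qed

lemma
  assumes "\<rho> \<in> {0..1}"
  shows lower_add: "lower (u \<oplus>\<^sub>F v) \<rho> = lower u \<rho> + lower v \<rho>"
    and upper_add: "upper (u \<oplus>\<^sub>F v) \<rho> = upper u \<rho> + upper v \<rho>"
proof -
  have "\<exists>!w. \<forall>\<rho>\<in>{0..1}. lower w \<rho> = lower u \<rho> + lower v \<rho> \<and> upper w \<rho> = upper u \<rho> + upper v \<rho>"
  proof (rule fuzzy_representation)
    show "((\<lambda>\<rho>. lower u \<rho> + lower v \<rho>) \<longlongrightarrow> lower u \<rho> + lower v \<rho>) (at_left \<rho>)"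
      "((\<lambda>\<rho>. upper u \<rho> + upper v \<rho>) \<longlongrightarrow> upper u \<rho> + upper v \<rho>) (at_left \<rho>)"
      if "0 < \<rho>" "\<rho> \<le> 1" for \<rho>
      by (intro tendsto_add lower_left_cont upper_left_cont that)+
    show "((\<lambda>\<rho>. lower u \<rho> + lower v \<rho>) \<longlongrightarrow> lower u 0 + lower v 0) (at_right 0)"
      "((\<lambda>\<rho>. upper u \<rho> + upper v \<rho>) \<longlongrightarrow> upper u 0 + upper v 0) (at_right 0)"
      by (intro tendsto_add lower_right_cont0 upper_right_cont0)+
  qed (intro add_mono lower_upper_mono lower_le_upper; assumption)+
  from bspec[OF theI'[OF this, folded fuzzy_add_def] assms]
  show "lower (u \<oplus>\<^sub>F v) \<rho> = lower u \<rho> + lower v \<rho>" "upper (u \<oplus>\<^sub>F v) \<rho> = upper u \<rho> + upper v \<rho>"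
    by simp_all
qed

lemma
  assumes "0 \<le> \<alpha>" "\<rho> \<in> {0..1}"
  shows lower_scale: "lower (\<alpha> \<cdot>\<^sub>F u) \<rho> = \<alpha> * lower u \<rho>"
    and upper_scale: "upper (\<alpha> \<cdot>\<^sub>F u) \<rho> = \<alpha> * upper u \<rho>"
proof -
  have "\<exists>!w. \<forall>\<rho>\<in>{0..1}. lower w \<rho> = \<alpha> * lower u \<rho> \<and> upper w \<rho> = \<alpha> * upper u \<rho>"
  proof (rule fuzzy_representation)
    show "((\<lambda>\<rho>. \<alpha> * lower u \<rho>) \<longlongrightarrow> \<alpha> * lower u \<rho>) (at_left \<rho>)"
      "((\<lambda>\<rho>. \<alpha> * upper u \<rho>) \<longlongrightarrow> \<alpha> * upper u \<rho>) (at_left \<rho>)"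
      if "0 < \<rho>" "\<rho> \<le> 1" for \<rho>
      by (intro tendsto_mult_left lower_left_cont upper_left_cont that)+
    show "((\<lambda>\<rho>. \<alpha> * lower u \<rho>) \<longlongrightarrow> \<alpha> * lower u 0) (at_right 0)"
      "((\<lambda>\<rho>. \<alpha> * upper u \<rho>) \<longlongrightarrow> \<alpha> * upper u 0) (at_right 0)"
      by (intro tendsto_mult_left lower_right_cont0 upper_right_cont0)+
  qed (intro mult_left_mono lower_upper_mono lower_le_upper assms(1); assumption)+
  from bspec[OF theI'[OF this, folded fuzzy_scale_def] assms(2)]
  show "lower (\<alpha> \<cdot>\<^sub>F u) \<rho> = \<alpha> * lower u \<rho>" "upper (\<alpha> \<cdot>\<^sub>F u) \<rho> = \<alpha> * upper u \<rho>"
    by simp_all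
qed


section \<open>Recurrent iterated function systems\<close>

text \<open>
  Throughout, \<open>x\<close> is the sequence of nodes \<open>x\<^sub>0 < \<dots> < x\<^sub>n\<close> and \<open>s\<close>, \<open>e\<close> give the
  endpoint indices of the domain intervals. Only the indices \<open>{1..n}\<close>
  (\<open>{0..n}\<close> for the nodes) are relevant.
\<close>

definition piece :: "(nat \<Rightarrow> real) \<Rightarrow> nat \<Rightarrow> real set" where
  "piece x i = {x (i - 1)..x i}"

definition dom_ivl :: "(nat \<Rightarrow> real) \<Rightarrow> (nat \<Rightarrow> nat) \<Rightarrow> (nat \<Rightarrow> nat) \<Rightarrow> nat \<Rightarrow> real set" where
  "dom_ivl x s e i = {x (s i)..x (e i)}"

definition ratio :: "(nat \<Rightarrow> real) \<Rightarrow> (nat \<Rightarrow> nat) \<Rightarrow> (nat \<Rightarrow> nat) \<Rightarrow> nat \<Rightarrow> real" where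
  "ratio x s e i = (x i - x (i - 1)) / (x (e i) - x (s i))"

definition l_map :: "(nat \<Rightarrow> real) \<Rightarrow> (nat \<Rightarrow> nat) \<Rightarrow> (nat \<Rightarrow> nat) \<Rightarrow> nat \<Rightarrow> real \<Rightarrow> real" where
  "l_map x s e i t = ratio x s e i * (t - x (s i)) + x (i - 1)"

definition F_map ::
  "(nat \<Rightarrow> real) \<Rightarrow> (nat \<Rightarrow> nat) \<Rightarrow> (nat \<Rightarrow> nat) \<Rightarrow> (nat \<Rightarrow> real) \<Rightarrow> (nat \<Rightarrow> real \<Rightarrow> fuzzy)
    \<Rightarrow> nat \<Rightarrow> real \<Rightarrow> fuzzy \<Rightarrow> fuzzy" where
  "F_map x s e \<alpha> q i t u = \<alpha> i \<cdot>\<^sub>F u \<oplus>\<^sub>F q i (l_map x s e i t)"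

definition w_map ::
  "(nat \<Rightarrow> real) \<Rightarrow> (nat \<Rightarrow> nat) \<Rightarrow> (nat \<Rightarrow> nat) \<Rightarrow> (nat \<Rightarrow> real) \<Rightarrow> (nat \<Rightarrow> real \<Rightarrow> fuzzy)
    \<Rightarrow> nat \<Rightarrow> real \<times> fuzzy \<Rightarrow> real \<times> fuzzy" where
  "w_map x s e \<alpha> q i = (\<lambda>(t, u). (l_map x s e i t, F_map x s e \<alpha> q i t u))"

definition rifs_matrix ::
  "nat \<Rightarrow> (nat \<Rightarrow> real) \<Rightarrow> (nat \<Rightarrow> nat) \<Rightarrow> (nat \<Rightarrow> nat) \<Rightarrow> nat \<Rightarrow> nat \<Rightarrow> real" where
  "rifs_matrix n x s e k t =
     (if piece x k \<subseteq> dom_ivl x s e t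
      then 1 / real (card {i \<in> {1..n}. piece x k \<subseteq> dom_ivl x s e i}) else 0)"

(* Irreducibility of a nonnegative matrix indexed by {1..n}: any two indices are joined by
   a chain of at least one step with positive entries. *)
definition irreducible_matrix :: "nat \<Rightarrow> (nat \<Rightarrow> nat \<Rightarrow> real) \<Rightarrow> bool" where
  "irreducible_matrix n p \<longleftrightarrow>
     (\<forall>i\<in>{1..n}. \<forall>j\<in>{1..n}. (i, j) \<in> {(k, t). k \<in> {1..n} \<and> t \<in> {1..n} \<and> 0 < p k t}\<^sup>+)"

definition conn_set ::
  "nat \<Rightarrow> (nat \<Rightarrow> real) \<Rightarrow> (nat \<Rightarrow> nat) \<Rightarrow> (nat \<Rightarrow> nat) \<Rightarrow> nat \<Rightarrow> nat set" where
  "conn_set n x s e i = {j \<in> {1..n}. piece x j \<subseteq> dom_ivl x s e i}"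

(* Compactness is taken in the product topology, which is the topology of each of the metrics
   |x - y| + \<theta> dist u v with \<theta> > 0; see theta_metric_topology below. *)
definition rifs_attractor ::
  "nat \<Rightarrow> (nat \<Rightarrow> real) \<Rightarrow> (nat \<Rightarrow> nat) \<Rightarrow> (nat \<Rightarrow> nat)
    \<Rightarrow> (nat \<Rightarrow> real \<times> fuzzy \<Rightarrow> real \<times> fuzzy) \<Rightarrow> (real \<times> fuzzy) set \<Rightarrow> bool" where
  "rifs_attractor n x s e w A \<longleftrightarrow>
     (\<exists>B. (\<forall>i\<in>{1..n}. B i \<noteq> {} \<and> compact (B i) \<and> B i \<subseteq> piece x i \<times> UNIV) \<and>
          (\<forall>i\<in>{1..n}. B i = (\<Union>j\<in>conn_set n x s e i. w i ` B j)) \<and>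
          A = (\<Union>i\<in>{1..n}. B i))"

definition theta_dist :: "real \<Rightarrow> real \<times> fuzzy \<Rightarrow> real \<times> fuzzy \<Rightarrow> real" where
  "theta_dist \<theta> = (\<lambda>(x, u) (y, v). \<bar>x - y\<bar> + \<theta> * dist u v)"

lemma theta_metric_topology:
  assumes "0 < \<theta>"
  shows "Metric_space UNIV (theta_dist \<theta>)"
    and "Metric_space.mtopology UNIV (theta_dist \<theta>) = euclidean"
proof -
  show M: "Metric_space UNIV (theta_dist \<theta>)"
  proof
    fix p q r :: "real \<times> fuzzy"
    obtain x u y v z w where pqr: "p = (x, u)" "q = (y, v)" "r = (z, w)"
      by (metis surj_pair)
    show "0 \<le> theta_dist \<theta> p q" using assms by (simp add: pqr theta_dist_def)
    show "theta_dist \<theta> p q = theta_dist \<theta> q p"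
      by (simp add: pqr theta_dist_def dist_commute abs_minus_commute)
    show "theta_dist \<theta> p q = 0 \<longleftrightarrow> p = q"
      using assms by (auto simp: pqr theta_dist_def add_nonneg_eq_0_iff)
    have "\<theta> * dist u w \<le> \<theta> * (dist u v + dist v w)"
      using assms dist_triangle by (intro mult_left_mono) auto
    then show "theta_dist \<theta> p r \<le> theta_dist \<theta> p q + theta_dist \<theta> q r"
      by (simp add: pqr theta_dist_def distrib_left)
  qed
  have upper_bd: "theta_dist \<theta> p q \<le> (1 + \<theta>) * dist p q" for p q
  proof -
    have "dist (fst p) (fst q) \<le> dist p q" by (rule dist_fst_le)
    moreover have "\<theta> * dist (snd p) (snd q) \<le> \<theta> * dist p q"
      using assms by (intro mult_left_mono dist_snd_le) auto
    ultimately show ?thesis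
      by (simp add: theta_dist_def case_prod_unfold dist_real_def distrib_right)
  qed
  have lower_bd: "dist p q \<le> (1 + 1 / \<theta>) * theta_dist \<theta> p q" for p q
  proof -
    have "dist p q \<le> dist (fst p) (fst q) + dist (snd p) (snd q)"
      unfolding dist_prod_def by (rule sqrt_sum_squares_le_sum) auto
    also have "\<dots> \<le> (1 + 1 / \<theta>) * theta_dist \<theta> p q"
      using assms by (simp add: theta_dist_def case_prod_unfold dist_real_def field_simps)
    finally show ?thesis .
  qed
  show "Metric_space.mtopology UNIV (theta_dist \<theta>) = euclidean"
  proof (rule topology_eq[THEN iffD2], intro allI)
    fix U :: "(real \<times> fuzzy) set"
    have "(\<forall>p\<in>U. \<exists>r>0. \<forall>q. theta_dist \<theta> p q < r \<longrightarrow> q \<in> U) \<longleftrightarrow>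
          (\<forall>p\<in>U. \<exists>r>0. \<forall>q. dist q p < r \<longrightarrow> q \<in> U)" (is "?L \<longleftrightarrow> ?R")
    proof
      assume L: ?L
      show ?R
      proof
        fix p assume "p \<in> U"
        then obtain r where r: "r > 0" "\<And>q. theta_dist \<theta> p q < r \<Longrightarrow> q \<in> U" using L by blast
        have "q \<in> U" if "dist q p < r / (1 + \<theta>)" for q
        proof (rule r(2))
          have "(1 + \<theta>) * dist p q < r"
            using that assms by (simp add: field_simps dist_commute)
          then show "theta_dist \<theta> p q < r" using upper_bd[of p q] by simp
        qed
        moreover have "r / (1 + \<theta>) > 0" using r assms by simp
        ultimately show "\<exists>r>0. \<forall>q. dist q p < r \<longrightarrow> q \<in> U" by blast
      qed
    next
      assume R: ?R
      show ?L
      proof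
        fix p assume "p \<in> U"
        then obtain r where r: "r > 0" "\<And>q. dist q p < r \<Longrightarrow> q \<in> U" using R by blast
        have pos: "0 < 1 + 1 / \<theta>" using assms by (simp add: add_pos_pos)
        have "q \<in> U" if "theta_dist \<theta> p q < r / (1 + 1 / \<theta>)" for q
        proof (rule r(2))
          have "(1 + 1 / \<theta>) * theta_dist \<theta> p q < r"
            using that pos by (simp add: pos_less_divide_eq mult.commute)
          then show "dist q p < r" using lower_bd[of p q] by (simp add: dist_commute)
        qed
        moreover have "r / (1 + 1 / \<theta>) > 0" using r pos by simp
        ultimately show "\<exists>r>0. \<forall>q. theta_dist \<theta> p q < r \<longrightarrow> q \<in> U" by blast
      qed
    qed
    then show "openin (Metric_space.mtopology UNIV (theta_dist \<theta>)) U \<longleftrightarrow> openin euclidean U"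
      by (simp add: Metric_space.openin_mtopology[OF M] Metric_space.mball_def[OF M]
          open_dist subset_iff Ball_def)
  qed
qed

end

theory Submission
  imports Defs
begin

text \<open>
  Rather than constructing the interpolation function as a fixed point of an operator on a
  function space and then identifying its graph with the attractor, the proof reads the function
  off the compact sets \<open>B\<^sub>1, \<dots>, B\<^sub>n\<close> whose union is \<open>A\<close>. Three quantities turn out to vanish, each
  for the same reason: the invariance \<open>B\<^sub>i = \<Union>\<^sub>j w\<^sub>i(B\<^sub>j)\<close> bounds each of its instances by a
  factor below \<open>1\<close> times another instance, and compactness keeps the instances bounded
  (\<open>self_improving_zero\<close>).

  \<^item> The distance from a point of \<open>I\<^sub>i\<close> to the projection of \<open>B\<^sub>i\<close> is shrunk by the ratio of
    \<open>l\<^sub>i\<close>, since the pieces making up the domain interval cover it. Hence \<open>B\<^sub>i\<close> lies over all of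
    \<open>I\<^sub>i\<close> (\<open>projection_covers_piece\<close>).
  \<^item> The distance from a value of \<open>A\<close> over a node \<open>x\<^sub>k\<close> to \<open>u\<^sub>k\<close> is shrunk by some \<open>\<alpha>\<^sub>i\<close>, because
    \<open>l\<^sub>i\<close> sends the endpoints of the domain interval, which are nodes, to nodes, and the join-up
    conditions say that \<open>w\<^sub>i\<close> carries the data points along. Hence \<open>u\<^sub>k\<close> is the only value of \<open>A\<close>
    over \<open>x\<^sub>k\<close> (\<open>value_over_node\<close>).
  \<^item> The distance between two values of \<open>A\<close> over one point is again shrunk by some \<open>\<alpha>\<^sub>i\<close> when
    both belong to one \<open>B\<^sub>i\<close>; otherwise the point is a node common to two pieces, where the
    previous item applies. Hence \<open>A\<close> is a graph (\<open>value_unique\<close>).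

  So the first projection maps the compact set \<open>A\<close> injectively onto the whole interval. The inverse
  of a continuous injection of a compact set is continuous, and its second component is the
  required function.
\<close>

section \<open>Contraction estimates\<close>

text \<open>
  The supremum \<open>M\<close> of the set satisfies \<open>M \<le> c M\<close>, hence \<open>M \<le> 0\<close>.
\<close>

lemma self_improving_zero:
  fixes S :: "real set"
  assumes c: "0 \<le> c" "c < 1"
    and bdd: "bdd_above S"
    and nonneg: "\<And>r. r \<in> S \<Longrightarrow> 0 \<le> r"
    and improve: "\<And>r. r \<in> S \<Longrightarrow> \<exists>r'\<in>S. r \<le> c * r'"
    and r: "r \<in> S"
  shows "r = 0"
proof -
  have le: "r' \<le> Sup S" if "r' \<in> S" for r'
    using that bdd by (rule cSup_upper)
  have "Sup S \<le> c * Sup S"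
  proof (rule cSup_least)
    show "S \<noteq> {}" using r by blast
    fix r' assume "r' \<in> S"
    then obtain r'' where "r'' \<in> S" "r' \<le> c * r''" using improve by blast
    then show "r' \<le> c * Sup S" using le c(1) by (meson mult_left_mono order_trans)
  qed
  then have "(1 - c) * Sup S \<le> 0" by (simp add: algebra_simps)
  then have "Sup S \<le> 0" using c(2) by (simp add: mult_le_0_iff)
  then show ?thesis using le[OF r] nonneg[OF r] by linarith
qed

text \<open>
  One factor for all maps of a finite system, so that the improvement is uniform.
\<close>

lemma uniform_factor:
  fixes c :: "'i \<Rightarrow> real"
  assumes "finite N" "\<And>i. i \<in> N \<Longrightarrow> c i < 1"
  obtains b where "0 \<le> b" "b < 1" "\<And>i. i \<in> N \<Longrightarrow> c i \<le> b"
proof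
  let ?b = "Max (insert 0 (c ` N))"
  show "0 \<le> ?b" "\<And>i. i \<in> N \<Longrightarrow> c i \<le> ?b" using assms(1) by simp_all
  show "?b < 1" using assms by (subst Max_less_iff) auto
qed

lemma dist_scale_add_le:
  assumes "0 \<le> a"
  shows "dist (a \<cdot>\<^sub>F u \<oplus>\<^sub>F w) (a \<cdot>\<^sub>F v \<oplus>\<^sub>F w) \<le> a * dist u v"
proof (rule dist_fuzzy_leI)
  fix \<rho> :: real assume \<rho>: "\<rho> \<in> {0..1}"
  have "level_gap (a \<cdot>\<^sub>F u \<oplus>\<^sub>F w) (a \<cdot>\<^sub>F v \<oplus>\<^sub>F w) \<rho> = a * level_gap u v \<rho>"
    using assms \<rho>
    by (simp add: level_gap_def lower_add upper_add lower_scale upper_scale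
        max_mult_distrib_left abs_mult flip: right_diff_distrib)
  also have "\<dots> \<le> a * dist u v"
    using level_gap_le_dist[OF \<rho>] assms by (rule mult_left_mono)
  finally show "level_gap (a \<cdot>\<^sub>F u \<oplus>\<^sub>F w) (a \<cdot>\<^sub>F v \<oplus>\<^sub>F w) \<rho> \<le> a * dist u v" .
qed

section \<open>The invariant compact sets\<close>

text \<open>
  The sets \<open>B i\<close> are the components of the attractor.
\<close>

locale fuzzy_rifs =
  fixes n :: nat
    and x :: "nat \<Rightarrow> real"
    and u :: "nat \<Rightarrow> fuzzy"
    and s e :: "nat \<Rightarrow> nat"
    and \<alpha> :: "nat \<Rightarrow> real"
    and q :: "nat \<Rightarrow> real \<Rightarrow> fuzzy"
    and B :: "nat \<Rightarrow> (real \<times> fuzzy) set"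
  assumes nodes: "strict_mono_on {0..n} x"
    and indices: "\<And>i. i \<in> {1..n} \<Longrightarrow> s i < e i \<and> e i \<le> n"
    and ratio_less_1: "\<And>i. i \<in> {1..n} \<Longrightarrow> ratio x s e i < 1"
    and scale: "\<And>i. i \<in> {1..n} \<Longrightarrow> 0 \<le> \<alpha> i \<and> \<alpha> i < 1"
    and join_left: "\<And>i. i \<in> {1..n} \<Longrightarrow> F_map x s e \<alpha> q i (x (s i)) (u (s i)) = u (i - 1)"
    and join_right: "\<And>i. i \<in> {1..n} \<Longrightarrow> F_map x s e \<alpha> q i (x (e i)) (u (e i)) = u i"
    and B_nonempty: "\<And>i. i \<in> {1..n} \<Longrightarrow> B i \<noteq> {}"
    and B_compact: "\<And>i. i \<in> {1..n} \<Longrightarrow> compact (B i)"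
    and B_over_piece: "\<And>i. i \<in> {1..n} \<Longrightarrow> B i \<subseteq> piece x i \<times> UNIV"
    and B_invariant:
      "\<And>i. i \<in> {1..n} \<Longrightarrow> B i = (\<Union>j\<in>conn_set n x s e i. w_map x s e \<alpha> q i ` B j)"
begin

subsection \<open>Nodes, pieces and the maps between them\<close>

lemma node_le: "i \<le> j \<Longrightarrow> j \<le> n \<Longrightarrow> x i \<le> x j"
  using mono_onD[OF strict_mono_on_imp_mono_on[OF nodes], of i j] by simp

lemma node_less: "i < j \<Longrightarrow> j \<le> n \<Longrightarrow> x i < x j"
  using strict_mono_onD[OF nodes, of i j] by simp

lemma piece_subset: "i \<in> {1..n} \<Longrightarrow> piece x i \<subseteq> {x 0..x n}"
  using node_le[of 0 "i - 1"] node_le[of i n] by (auto simp: piece_def)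

lemma point_in_piece:
  assumes "a < b" "b \<le> n" "t \<in> {x a..x b}"
  obtains j where "a < j" "j \<le> b" "t \<in> piece x j"
proof -
  \<comment> \<open>the first node to the right of \<open>t\<close> bounds the piece that contains \<open>t\<close>\<close>
  define j where "j = (LEAST k. a < k \<and> t \<le> x k)"
  have b: "a < b \<and> t \<le> x b" using assms by simp
  have j: "a < j \<and> t \<le> x j"
    unfolding j_def using b by (rule LeastI)
  have "j \<le> b"
    unfolding j_def using b by (rule Least_le)
  have "x (j - 1) \<le> t"
  proof (cases "a < j - 1")
    case True
    then show ?thesis
      using not_less_Least[of "j - 1" "\<lambda>k. a < k \<and> t \<le> x k", folded j_def] by simp
  next
    case False
    then have "j - 1 = a" using j by linarith
    then show ?thesis using assms by simp
  qed
  then show ?thesis using that j \<open>j \<le> b\<close> by (auto simp: piece_def)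
qed

lemma node_in_piece:
  assumes "i \<in> {1..n}" "k \<le> n" "x k \<in> piece x i"
  shows "k = i - 1 \<or> k = i"
proof (rule ccontr)
  assume "\<not> (k = i - 1 \<or> k = i)"
  then have "k < i - 1 \<or> i < k" by linarith
  then have "x k < x (i - 1) \<or> x i < x k"
    using node_less[of k "i - 1"] node_less[of i k] assms by fastforce
  then show False using assms by (auto simp: piece_def)
qed

lemma common_point_is_node:
  assumes "i \<in> {1..n}" "j \<in> {1..n}" "i < j" "t \<in> piece x i" "t \<in> piece x j"
  shows "t = x i"
proof -
  have "x i \<le> x (j - 1)" using assms by (intro node_le) auto
  then show ?thesis using assms by (auto simp: piece_def)
qed

lemma ratio_pos:
  assumes "i \<in> {1..n}"
  shows "0 < ratio x s e i"
  using node_less[of "s i" "e i"] node_less[of "i - 1" i] indices[OF assms] assms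
  by (simp add: ratio_def)

lemma l_map_left: "l_map x s e i (x (s i)) = x (i - 1)"
  by (simp add: l_map_def)

lemma l_map_right:
  assumes "i \<in> {1..n}"
  shows "l_map x s e i (x (e i)) = x i"
  using node_less[of "s i" "e i"] indices[OF assms] by (simp add: l_map_def ratio_def)

lemma dist_l_map:
  assumes "i \<in> {1..n}"
  shows "dist (l_map x s e i t) (l_map x s e i t') = ratio x s e i * dist t t'"
proof -
  have "l_map x s e i t - l_map x s e i t' = ratio x s e i * (t - t')"
    by (simp add: l_map_def algebra_simps)
  then show ?thesis using ratio_pos[OF assms] by (simp add: dist_real_def abs_mult)
qed

lemma l_map_eq_iff:
  assumes "i \<in> {1..n}"
  shows "l_map x s e i t = l_map x s e i t' \<longleftrightarrow> t = t'"
  using ratio_pos[OF assms] by (simp add: l_map_def)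

lemma conn_set_subset: "j \<in> conn_set n x s e i \<Longrightarrow> j \<in> {1..n}"
  by (simp add: conn_set_def)

lemma l_map_preimage:
  assumes i: "i \<in> {1..n}" and t: "t \<in> piece x i"
  obtains j t' where "j \<in> conn_set n x s e i" "t' \<in> piece x j" "l_map x s e i t' = t"
proof -
  have c: "0 < ratio x s e i" by (rule ratio_pos[OF i])
  define t' where "t' = (t - x (i - 1)) / ratio x s e i + x (s i)"
  have l: "l_map x s e i t' = t" using c by (simp add: l_map_def t'_def)
  have "x (s i) \<le> t'" using t c by (simp add: t'_def piece_def)
  moreover have "ratio x s e i * (x (e i) - t') \<ge> 0"
    using l_map_right[OF i] l t unfolding l_map_def piece_def by (simp add: algebra_simps)
  then have "t' \<le> x (e i)" using c by (simp add: zero_le_mult_iff)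
  ultimately obtain j where j: "s i < j" "j \<le> e i" "t' \<in> piece x j"
    using point_in_piece[of "s i" "e i" t'] indices[OF i] by auto
  have "piece x j \<subseteq> dom_ivl x s e i"
    using node_le[of "s i" "j - 1"] node_le[of j "e i"] j indices[OF i]
    by (auto simp: piece_def dom_ivl_def)
  then have "j \<in> conn_set n x s e i" using j indices[OF i] by (auto simp: conn_set_def)
  then show ?thesis using that j l by blast
qed

subsection \<open>The attractor over its base interval\<close>

lemma w_map_in_B:
  assumes "i \<in> {1..n}" "j \<in> conn_set n x s e i" "(t, v) \<in> B j"
  shows "(l_map x s e i t, F_map x s e \<alpha> q i t v) \<in> B i"
proof -
  have "w_map x s e \<alpha> q i (t, v) \<in> B i"
    unfolding B_invariant[OF assms(1)] using assms by blast
  then show ?thesis by (simp add: w_map_def)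
qed

lemma B_preimage:
  assumes "i \<in> {1..n}" "(t, v) \<in> B i"
  obtains j t' v' where "j \<in> {1..n}" "(t', v') \<in> B j"
    "t = l_map x s e i t'" "v = F_map x s e \<alpha> q i t' v'"
  using assms(2) unfolding B_invariant[OF assms(1)]
  by (auto simp: w_map_def dest: conn_set_subset)

text \<open>
  Only values over a common abscissa are compared; there the contributions of \<open>q i\<close> coincide, so
  the scaling by \<open>\<alpha> i\<close> alone determines the distance.
\<close>

lemma dist_F_map_le:
  assumes "i \<in> {1..n}"
  shows "dist (F_map x s e \<alpha> q i t v) (F_map x s e \<alpha> q i t v') \<le> \<alpha> i * dist v v'"
  unfolding F_map_def using scale[OF assms] by (intro dist_scale_add_le) simp

definition attr :: "(real \<times> fuzzy) set" where
  "attr = (\<Union>i\<in>{1..n}. B i)"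

lemma attr_compact: "compact attr"
  unfolding attr_def using B_compact by (intro compact_UN) auto

text \<open>
  A point of \<open>piece x i\<close> is the image of a point \<open>t'\<close> of some piece \<open>j\<close> inside the domain
  interval; a point of the projection of \<open>B j\<close> nearest to \<open>t'\<close> is mapped into the projection of
  \<open>B i\<close>, at a distance smaller by the ratio.
\<close>

lemma projection_covers_piece:
  assumes "i \<in> {1..n}"
  shows "fst ` B i = piece x i"
proof
  show "fst ` B i \<subseteq> piece x i" using B_over_piece[OF assms] by force
next
  obtain c where c: "0 \<le> c" "c < 1" "\<And>i. i \<in> {1..n} \<Longrightarrow> ratio x s e i \<le> c"
    using uniform_factor[of "{1..n}" "ratio x s e"] ratio_less_1 by auto
  define S where "S = {infdist t (fst ` B i) | i t. i \<in> {1..n} \<and> t \<in> piece x i}"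
  have compact: "compact (fst ` B i)" if "i \<in> {1..n}" for i
    using B_compact[OF that] by (intro compact_continuous_image continuous_intros)
  have zero: "r = 0" if "r \<in> S" for r
  proof (rule self_improving_zero[OF c(1,2) _ _ _ that])
    show "bdd_above S"
    proof (rule bdd_aboveI)
      fix r assume "r \<in> S"
      then obtain i t where it: "i \<in> {1..n}" "t \<in> piece x i" "r = infdist t (fst ` B i)"
        by (auto simp: S_def)
      obtain p where p: "p \<in> fst ` B i" using B_nonempty[OF it(1)] by blast
      then have "p \<in> piece x i" using B_over_piece[OF it(1)] by force
      then have "dist t p \<le> x n - x 0"
        using subsetD[OF piece_subset[OF it(1)], of t] subsetD[OF piece_subset[OF it(1)], of p] it(2)
        by (auto simp: dist_real_def)
      then show "r \<le> x n - x 0" using infdist_le[OF p, of t] it(3) by linarith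
    qed
  next
    fix r assume "r \<in> S"
    then obtain i t where it: "i \<in> {1..n}" "t \<in> piece x i" "r = infdist t (fst ` B i)"
      by (auto simp: S_def)
    obtain j t' where j: "j \<in> conn_set n x s e i" "t' \<in> piece x j" "l_map x s e i t' = t"
      using l_map_preimage[OF it(1,2)] .
    have jn: "j \<in> {1..n}" by (rule conn_set_subset[OF j(1)])
    obtain p where p: "p \<in> fst ` B j" "infdist t' (fst ` B j) = dist t' p"
      using infdist_attains_inf[of "fst ` B j" t'] compact_imp_closed[OF compact[OF jn]]
        B_nonempty[OF jn] by auto
    have "l_map x s e i p \<in> fst ` B i"
      using p(1) w_map_in_B[OF it(1) j(1)] by force
    then have "r \<le> dist (l_map x s e i t') (l_map x s e i p)"
      using infdist_le it(3) j(3) by simp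
    also have "\<dots> \<le> c * infdist t' (fst ` B j)"
      unfolding dist_l_map[OF it(1)] p(2) using c(3)[OF it(1)] by (intro mult_right_mono) auto
    finally show "\<exists>r'\<in>S. r \<le> c * r'" using jn j(2) by (auto simp: S_def)
  qed (auto simp: S_def infdist_nonneg)
  show "piece x i \<subseteq> fst ` B i"
  proof
    fix t assume "t \<in> piece x i"
    then have "infdist t (fst ` B i) = 0" using assms by (intro zero) (auto simp: S_def)
    then show "t \<in> fst ` B i"
      using in_closed_iff_infdist_zero[of "fst ` B i" t] compact_imp_closed[OF compact[OF assms]]
        B_nonempty[OF assms] by simp
  qed
qed

lemma attr_projection:
  assumes "0 < n"
  shows "fst ` attr = {x 0..x n}"
proof -
  have "fst ` attr = (\<Union>i\<in>{1..n}. piece x i)"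
    using projection_covers_piece by (auto simp: attr_def image_UN)
  also have "\<dots> = {x 0..x n}"
  proof
    show "{x 0..x n} \<subseteq> (\<Union>i\<in>{1..n}. piece x i)"
    proof
      fix t assume "t \<in> {x 0..x n}"
      then show "t \<in> (\<Union>i\<in>{1..n}. piece x i)"
        using point_in_piece[of 0 n t] assms by force
    qed
  qed (use piece_subset in blast)
  finally show ?thesis .
qed

text \<open>
  A point of \<open>A\<close> over a node is the image under some \<open>w_map\<close> of a point of \<open>A\<close> over an endpoint of
  the corresponding domain interval, which is a node again.
\<close>

lemma value_over_node:
  assumes "k \<le> n" "(x k, v) \<in> attr"
  shows "v = u k"
proof -
  obtain c where c: "0 \<le> c" "c < 1" "\<And>i. i \<in> {1..n} \<Longrightarrow> \<alpha> i \<le> c"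
    by (rule uniform_factor[of "{1..n}" \<alpha>]) (use scale in auto)
  define S where "S = {dist v (u k) | v k. k \<le> n \<and> (x k, v) \<in> attr}"
  have "dist v (u k) = 0"
  proof (rule self_improving_zero[OF c(1,2)])
    have "bounded (snd ` attr)"
      using attr_compact
      by (intro compact_imp_bounded compact_continuous_image continuous_intros)
    then have "bounded (snd ` attr \<union> u ` {0..n})" by (simp add: finite_imp_bounded)
    then obtain b where "\<forall>y\<in>snd ` attr \<union> u ` {0..n}. \<forall>z\<in>snd ` attr \<union> u ` {0..n}. dist y z \<le> b"
      unfolding bounded_two_points by blast
    then show "bdd_above S"
      by (intro bdd_aboveI[of _ b]) (force simp: S_def)
  next
    fix r assume "r \<in> S"
    then obtain k v where kv: "k \<le> n" "(x k, v) \<in> attr" "r = dist v (u k)"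
      by (auto simp: S_def)
    then obtain i where i: "i \<in> {1..n}" "(x k, v) \<in> B i" by (auto simp: attr_def)
    obtain j t' v' where j: "j \<in> {1..n}" "(t', v') \<in> B j"
      "x k = l_map x s e i t'" "v = F_map x s e \<alpha> q i t' v'"
      using B_preimage[OF i] .
    have "k = i - 1 \<or> k = i"
      using node_in_piece[OF i(1) kv(1)] B_over_piece[OF i(1)] i(2) by auto
    then obtain k' where k': "k' \<le> n" "t' = x k'" "F_map x s e \<alpha> q i (x k') (u k') = u k"
    proof
      assume k: "k = i - 1"
      then have "t' = x (s i)" using j(3) l_map_left l_map_eq_iff[OF i(1)] by metis
      then show ?thesis using that[of "s i"] join_left[OF i(1)] indices[OF i(1)] k by auto
    next
      assume k: "k = i"
      then have "t' = x (e i)" using j(3) l_map_right[OF i(1)] l_map_eq_iff[OF i(1)] by metis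
      then show ?thesis using that[of "e i"] join_right[OF i(1)] indices[OF i(1)] k by auto
    qed
    have "r \<le> \<alpha> i * dist v' (u k')"
      using dist_F_map_le[OF i(1), of t' v' "u k'"] kv(3) j(4) k' by simp
    also have "\<dots> \<le> c * dist v' (u k')" using c(3)[OF i(1)] by (intro mult_right_mono) auto
    finally have "r \<le> c * dist v' (u k')" .
    moreover have "dist v' (u k') \<in> S" using j(1,2) k'(1,2) unfolding S_def attr_def by blast
    ultimately show "\<exists>r'\<in>S. r \<le> c * r'" by blast
  qed (use assms in \<open>auto simp: S_def\<close>)
  then show ?thesis by simp
qed

text \<open>
  Two points of \<open>A\<close> over the same abscissa that lie in the same \<open>B i\<close> come from two points over a
  common abscissa, as \<open>l_map\<close> is injective.
\<close>

lemma value_unique: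
  assumes "(t, v) \<in> attr" "(t, v') \<in> attr"
  shows "v = v'"
proof -
  obtain c where c: "0 \<le> c" "c < 1" "\<And>i. i \<in> {1..n} \<Longrightarrow> \<alpha> i \<le> c"
    by (rule uniform_factor[of "{1..n}" \<alpha>]) (use scale in auto)
  define S where "S = {dist v v' | t v v'. (t, v) \<in> attr \<and> (t, v') \<in> attr}"
  have "dist v v' = 0"
  proof (rule self_improving_zero[OF c(1,2)])
    have "bounded (snd ` attr)"
      using attr_compact
      by (intro compact_imp_bounded compact_continuous_image continuous_intros)
    then obtain b where "\<forall>y\<in>snd ` attr. \<forall>z\<in>snd ` attr. dist y z \<le> b"
      unfolding bounded_two_points by blast
    then show "bdd_above S"
      by (intro bdd_aboveI[of _ b]) (force simp: S_def)
  next
    fix r assume "r \<in> S"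
    then obtain t v v' where tv: "(t, v) \<in> attr" "(t, v') \<in> attr" "r = dist v v'"
      by (auto simp: S_def)
    then obtain i i' where i: "i \<in> {1..n}" "(t, v) \<in> B i" and i': "i' \<in> {1..n}" "(t, v') \<in> B i'"
      by (auto simp: attr_def)
    show "\<exists>r'\<in>S. r \<le> c * r'"
    proof (cases "i = i'")
      case True
      obtain j z w where j: "j \<in> {1..n}" "(z, w) \<in> B j"
        "t = l_map x s e i z" "v = F_map x s e \<alpha> q i z w"
        using B_preimage[OF i] .
      obtain j' z' w' where j': "j' \<in> {1..n}" "(z', w') \<in> B j'"
        "t = l_map x s e i z'" "v' = F_map x s e \<alpha> q i z' w'"
        using B_preimage[OF i'] True by metis
      have z: "z' = z" using j(3) j'(3) l_map_eq_iff[OF i(1)] by metis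
      have "r \<le> \<alpha> i * dist w w'"
        using dist_F_map_le[OF i(1), of z w w'] tv(3) j(4) j'(4) z by simp
      also have "\<dots> \<le> c * dist w w'" using c(3)[OF i(1)] by (intro mult_right_mono) auto
      finally have "r \<le> c * dist w w'" .
      moreover have "dist w w' \<in> S" using j(1,2) j'(1,2) z unfolding S_def attr_def by blast
      ultimately show ?thesis by blast
    next
      case False
      have t: "t \<in> piece x i" "t \<in> piece x i'"
        using B_over_piece[OF i(1)] B_over_piece[OF i'(1)] i(2) i'(2) by auto
      \<comment> \<open>\<open>t\<close> is the right endpoint of the piece with the smaller index\<close>
      have "t = x (min i i')"
      proof (cases "i < i'")
        case True
        then show ?thesis using common_point_is_node[OF i(1) i'(1)] t by simp
      next
        case ge: False
        then show ?thesis
          using common_point_is_node[OF i'(1) i(1)] t \<open>i \<noteq> i'\<close> by (simp add: min_def)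
      qed
      then have "v = v'"
        using value_over_node[of "min i i'" v] value_over_node[of "min i i'" v'] tv i(1) by auto
      then have "r = 0" using tv(3) by simp
      then show ?thesis using \<open>r \<in> S\<close> by (intro bexI[of _ r]) simp_all
    qed
  qed (use assms in \<open>auto simp: S_def\<close>)
  then show ?thesis by simp
qed

theorem attr_is_graph:
  assumes "0 < n"
  shows "\<exists>f. continuous_on {x 0..x n} f \<and> attr = {(t, f t) | t. t \<in> {x 0..x n}}"
proof (intro exI conjI)
  let ?g = "the_inv_into attr fst"
  have inj: "inj_on fst attr" using value_unique by (force intro: inj_onI)
  have "continuous_on (fst ` attr) ?g"
    by (rule continuous_on_inv[OF _ attr_compact])
      (auto intro: continuous_intros the_inv_into_f_f[OF inj])
  then show "continuous_on {x 0..x n} (\<lambda>t. snd (?g t))"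
    using attr_projection[OF assms] by (auto intro: continuous_intros)
  have g: "?g t \<in> attr" "fst (?g t) = t" if "t \<in> {x 0..x n}" for t
    using that attr_projection[OF assms] the_inv_into_into[OF inj, of t attr]
      f_the_inv_into_f[OF inj, of t] by auto
  show "attr = {(t, snd (?g t)) | t. t \<in> {x 0..x n}}"
  proof
    show "attr \<subseteq> {(t, snd (?g t)) | t. t \<in> {x 0..x n}}"
    proof
      fix p assume p: "p \<in> attr"
      then have "fst p \<in> {x 0..x n}" using attr_projection[OF assms] by blast
      moreover have "p = (fst p, snd (?g (fst p)))" using the_inv_into_f_f[OF inj p] by simp
      ultimately show "p \<in> {(t, snd (?g t)) | t. t \<in> {x 0..x n}}" by blast
    qed
    show "{(t, snd (?g t)) | t. t \<in> {x 0..x n}} \<subseteq> attr"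
    proof
      fix p assume "p \<in> {(t, snd (?g t)) | t. t \<in> {x 0..x n}}"
      then obtain t where "p = (t, snd (?g t))" "t \<in> {x 0..x n}" by blast
      then have "p = ?g t" using g(2) by (metis prod.collapse)
      then show "p \<in> attr" using g(1) \<open>t \<in> {x 0..x n}\<close> by simp
    qed
  qed
qed

end

section \<open>The graph theorem\<close>

theorem theorem2:
  fixes n :: nat
    and x :: "nat \<Rightarrow> real"
    and u :: "nat \<Rightarrow> fuzzy"
    and s e :: "nat \<Rightarrow> nat"
    and \<alpha> :: "nat \<Rightarrow> real"
    and q :: "nat \<Rightarrow> real \<Rightarrow> fuzzy"
    and A :: "(real \<times> fuzzy) set"
  assumes "n \<ge> 2"
    and "strict_mono_on {0..n} x"
    and "\<And>i. i \<in> {1..n} \<Longrightarrow> s i < e i \<and> e i \<le> n \<and> e i - s i \<ge> 2"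
    and "\<And>i. i \<in> {1..n} \<Longrightarrow> ratio x s e i < 1"
    and "\<And>i. i \<in> {1..n} \<Longrightarrow> 0 \<le> \<alpha> i \<and> \<alpha> i < 1"
    and "\<And>i. i \<in> {1..n} \<Longrightarrow> \<exists>L. L-lipschitz_on (piece x i) (q i)"
    and "\<And>i. i \<in> {1..n} \<Longrightarrow> F_map x s e \<alpha> q i (x (s i)) (u (s i)) = u (i - 1)"
    and "\<And>i. i \<in> {1..n} \<Longrightarrow> F_map x s e \<alpha> q i (x (e i)) (u (e i)) = u i"
    and "irreducible_matrix n (rifs_matrix n x s e)"
    and "rifs_attractor n x s e (w_map x s e \<alpha> q) A"
  shows "\<exists>f :: real \<Rightarrow> fuzzy.
           continuous_on {x 0..x n} f \<and> A = {(t, f t) | t. t \<in> {x 0..x n}}"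
proof -
  obtain B where B: "\<forall>i\<in>{1..n}. B i \<noteq> {} \<and> compact (B i) \<and> B i \<subseteq> piece x i \<times> UNIV"
    "\<forall>i\<in>{1..n}. B i = (\<Union>j\<in>conn_set n x s e i. w_map x s e \<alpha> q i ` B j)"
    "A = (\<Union>i\<in>{1..n}. B i)"
    using assms(10) unfolding rifs_attractor_def by blast
  interpret fuzzy_rifs n x u s e \<alpha> q B
    by unfold_locales (use assms(2-8) B(1,2) in auto)
  have "A = attr" by (simp add: B(3) attr_def)
  then show ?thesis using attr_is_graph assms(1) by simp
qed

end
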